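(* For any graph $G$, $$CAN(K_{\chi(G)},2)-1\;\le\; CAN(G,2)\;\le\; CAN(K_{\chi(G)},2).$$ Moreover, if $CAN(K_{\chi(G)},2)$ is odd, then $CAN(G,2)=CAN(K_{\chi(G)},2)$.
   Context: Graphs are finite and simple, $\chi(G)$ is the chromatic number, and $K_m$ the complete graph on $m$ vertices. Two vectors $u,v\in\{0,1\}^n$ are qualitatively independent if for every ordered pair $(a,b)\in\{0,1\}^2$ there is an index $i$ with $(u_i,v_i)=(a,b)$. A covering array $CA(n,G,2)$ is a $|V(G)|\times n$ array with entries from $\{0,1\}$ whose rows correspond to the vertices of $G$, such that any two rows corresponding to adjacent vertices are qualitatively independent. $CAN(G,2)$ is the smallest positive integer $n$ such that a $CA(n,G,2)$ exists. *)

theory Defs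
  imports "Graph_Theory.Graph_Theory" "HOL-Library.FuncSet"
begin

text \<open>
  As in the library, an undirected simple graph is a finite, loop-free, symmetric digraph without
  parallel arcs; adjacency of u and v is domination of v by u. The graph without vertices
  is not excluded.
\<close>

definition proper_coloring :: "('a, 'b) pre_digraph \<Rightarrow> nat \<Rightarrow> ('a \<Rightarrow> nat) \<Rightarrow> bool" where
  "proper_coloring G k c \<longleftrightarrow>
     c \<in> verts G \<rightarrow> {..<k} \<and> (\<forall>u v. u \<rightarrow>\<^bsub>G\<^esub> v \<longrightarrow> c u \<noteq> c v)"

definition chromatic_number :: "('a, 'b) pre_digraph \<Rightarrow> nat" where
  "chromatic_number G = (LEAST k. \<exists>c. proper_coloring G k c)"

definition complete_graph :: "nat \<Rightarrow> (nat, nat \<times> nat) pre_digraph" where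
  "complete_graph m =
     \<lparr> verts = {..<m}, arcs = {(u, v). u < m \<and> v < m \<and> u \<noteq> v}, tail = fst, head = snd \<rparr>"

lemma complete_digraph_complete_graph: "complete_digraph m (complete_graph m)"
proof -
  have "finite (arcs (complete_graph m))"
    by (rule finite_subset[of _ "{..<m} \<times> {..<m}"]) (auto simp: complete_graph_def)
  then have "graph (complete_graph m)"
    by unfold_locales
      (auto simp: complete_graph_def arc_to_ends_def symmetric_def arcs_ends_def sym_def)
  then show ?thesis
    by (auto simp: complete_digraph_def complete_graph_def arcs_ends_def arc_to_ends_def)
qed

text \<open>
  A vector of length \<open>n\<close> is a function on indices of which only the values at \<open>i < n\<close> matter.
\<close>

definition qualitatively_independent :: "nat \<Rightarrow> (nat \<Rightarrow> nat) \<Rightarrow> (nat \<Rightarrow> nat) \<Rightarrow> bool" where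
  "qualitatively_independent n u v \<longleftrightarrow>
     (\<forall>a\<in>{0, 1}. \<forall>b\<in>{0, 1}. \<exists>i<n. u i = a \<and> v i = b)"

definition covering_array :: "nat \<Rightarrow> ('a, 'b) pre_digraph \<Rightarrow> ('a \<Rightarrow> nat \<Rightarrow> nat) \<Rightarrow> bool" where
  "covering_array n G A \<longleftrightarrow>
     A \<in> verts G \<rightarrow> {..<n} \<rightarrow> {0, 1} \<and>
     (\<forall>u v. u \<rightarrow>\<^bsub>G\<^esub> v \<longrightarrow> qualitatively_independent n (A u) (A v))"

definition CAN :: "('a, 'b) pre_digraph \<Rightarrow> nat" where
  "CAN G = (LEAST n. 0 < n \<and> (\<exists>A. covering_array n G A))"

end

theory Submission
  imports Defs
begin

text \<open>
  A binary covering array of \<open>G\<close> with \<open>n\<close> columns is a family of subsets of \<open>{..<n}\<close>, one for each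
  vertex, in which adjacent vertices get crossing sets: sets for which all four regions of the Venn
  diagram are inhabited. A proper colouring of \<open>G\<close> with \<open>\<chi>(G)\<close> colours turns an array of the complete
  graph into one of \<open>G\<close>, which is the upper bound.

  For the lower bound let \<open>n > 0\<close> be even. The sets of size \<open>n/2\<close> that contain \<open>0\<close> cross pairwise, so
  every number of colours up to the number of these sets has an array with \<open>n\<close> columns. It remains
  to colour \<open>G\<close> by these sets. Crossing is not affected by complementation, so every set may be assumed to
  have at most \<open>n/2\<close> elements. Such a set is pushed up into the middle layer along the chains of a chain
  decomposition of the subset lattice, and the result is complemented if it misses \<open>0\<close>. Two sets
  with the same image are then comparable or disjoint up to complementation, hence do not cross
  (\<open>half_star_crossing_retraction\<close>). Therefore an array of \<open>G\<close> with an even number \<open>n\<close> of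
  columns yields an array of the complete graph on \<open>\<chi>(G)\<close> vertices with \<open>n\<close> columns
  (\<open>covering_array_complete_chromatic\<close>). If \<open>n\<close> is odd, one constant column is
  added first; this costs the \<open>1\<close> in the theorem, and it shows that the loss can only occur when
  \<open>CAN\<close> of the complete graph is even.

  The chains come from an injection \<open>A \<mapsto> \<phi> A \<supseteq> A\<close> that adds one element to each set with fewer than
  \<open>n/2\<close> elements: view \<open>A\<close> as a lattice path and reverse the step that leads to its first maximum
  (\<open>first_peak_injection\<close>).
\<close>

section \<open>An injection from small sets to the next layer\<close>

text \<open>
  The path of \<open>A\<close> steps down at the elements of \<open>A\<close> and up elsewhere; this is its height before
  the step \<open>j\<close>.
\<close>
definition walk_height :: "nat set \<Rightarrow> nat \<Rightarrow> int" where
  "walk_height A j = int j - 2 * int (card (A \<inter> {..<j}))"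

text \<open>The step \<open>p\<close> goes up and ends at the first maximum of the path on \<open>{..n}\<close>.\<close>
definition first_peak_step :: "nat \<Rightarrow> nat set \<Rightarrow> nat \<Rightarrow> bool" where
  "first_peak_step n A p \<longleftrightarrow> p < n \<and> p \<notin> A \<and>
     (\<forall>i\<le>p. walk_height A i \<le> walk_height A p) \<and>
     (\<forall>i. p < i \<and> i \<le> n \<longrightarrow> walk_height A i \<le> walk_height A p + 1)"

lemma walk_height_Suc:
  "walk_height A (Suc j) = walk_height A j + (if j \<in> A then -1 else 1)"
  by (auto simp: walk_height_def lessThan_Suc)

lemma walk_height_insert:
  assumes "p \<notin> A"
  shows "walk_height (insert p A) j = walk_height A j - (if p < j then 2 else 0)"
  using assms by (auto simp: walk_height_def Int_insert_left)

text \<open>The path of a set with fewer than \<open>n/2\<close> elements ends above its start, so its maximum is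
  reached by an up-step.\<close>
lemma first_peak_step_exists:
  assumes "A \<subseteq> {..<n}" "2 * card A < n"
  shows "\<exists>p. first_peak_step n A p"
proof -
  define peak where "peak j \<longleftrightarrow> j \<le> n \<and> (\<forall>i\<le>n. walk_height A i \<le> walk_height A j)" for j
  have "\<exists>j\<in>{..n}. \<forall>i\<in>{..n}. walk_height A i \<le> walk_height A j"
  proof -
    have "Max (walk_height A ` {..n}) \<in> walk_height A ` {..n}"
      by (rule Max_in) auto
    then obtain j where "j \<in> {..n}" "Max (walk_height A ` {..n}) = walk_height A j" by (rule imageE)
    then show ?thesis by (metis Max_ge finite_atMost finite_imageI imageI)
  qed
  then have ex: "\<exists>j. peak j" by (auto simp: peak_def)
  define j where "j = (LEAST j. peak j)"
  have j: "peak j" unfolding j_def using ex by (rule LeastI_ex)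
  have before: "walk_height A i < walk_height A j" if "i < j" for i
  proof -
    have "\<not> peak i" using that not_less_Least unfolding j_def by blast
    moreover have "i \<le> n" using that j by (simp add: peak_def)
    ultimately obtain i' where "i' \<le> n" "walk_height A i < walk_height A i'"
      by (auto simp: peak_def not_le)
    then show ?thesis using j by (force simp: peak_def)
  qed
  have "A \<inter> {..<n} = A" using assms by blast
  then have "walk_height A n > walk_height A 0"
    using assms by (simp add: walk_height_def)
  moreover have "walk_height A n \<le> walk_height A j" using j by (simp add: peak_def)
  ultimately have "j \<noteq> 0" by (metis not_le)
  then obtain p where p: "j = Suc p" using not0_implies_Suc by blast
  have up: "p \<notin> A" "walk_height A j = walk_height A p + 1"
    using before[of p] walk_height_Suc[of A p] p by (auto split: if_splits)
  have "walk_height A i \<le> walk_height A p" if "i \<le> p" for i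
    using before[of i] that p up by simp
  then have "first_peak_step n A p"
    using j p up by (auto simp: first_peak_step_def peak_def)
  then show ?thesis ..
qed

text \<open>
  Reversing the step \<open>p\<close> lowers everything after it by \<open>2\<close>, so in the new path \<open>p\<close> is the last
  position of maximal height, which can be read off from \<open>insert p A\<close> alone.
\<close>
lemma first_peak_step_insert_inject:
  assumes A: "first_peak_step n A p" and B: "first_peak_step n B q"
    and eq: "insert p A = insert q B"
  shows "A = B"
proof -
  have last: "(\<forall>i\<le>r. walk_height (insert r D) i \<le> walk_height (insert r D) r) \<and>
      (\<forall>i. r < i \<and> i \<le> n \<longrightarrow> walk_height (insert r D) i < walk_height (insert r D) r)"
    if "first_peak_step n D r" for D r
    using that by (fastforce simp: first_peak_step_def walk_height_insert)
  have "p \<le> n" "q \<le> n" using A B by (auto simp: first_peak_step_def)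
  then have "p = q"
    using last[OF A] last[OF B] unfolding eq
    by (metis linorder_neqE_nat less_imp_le not_le)
  then show ?thesis using A B eq by (auto simp: first_peak_step_def)
qed

lemma first_peak_injection:
  obtains \<phi> :: "nat set \<Rightarrow> nat set" where
    "\<And>A. A \<subseteq> {..<n} \<Longrightarrow> 2 * card A < n \<Longrightarrow>
       A \<subseteq> \<phi> A \<and> \<phi> A \<subseteq> {..<n} \<and> card (\<phi> A) = Suc (card A)"
    "inj_on \<phi> {A. A \<subseteq> {..<n} \<and> 2 * card A < n}"
proof
  define step where "step A = (SOME p. first_peak_step n A p)" for A
  have step: "first_peak_step n A (step A)" if "A \<subseteq> {..<n}" "2 * card A < n" for A
    unfolding step_def using first_peak_step_exists[OF that] by (rule someI_ex)
  show "A \<subseteq> insert (step A) A \<and> insert (step A) A \<subseteq> {..<n} \<and>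
      card (insert (step A) A) = Suc (card A)"
    if "A \<subseteq> {..<n}" "2 * card A < n" for A
    using step[OF that] that finite_subset[OF that(1)] by (auto simp: first_peak_step_def)
  show "inj_on (\<lambda>A. insert (step A) A) {A. A \<subseteq> {..<n} \<and> 2 * card A < n}"
    by (rule inj_onI, rule first_peak_step_insert_inject[OF step step]) auto
qed

section \<open>Pushing small sets into the middle layer\<close>

text \<open>
  Iterating the injection moves every small set to the middle layer. If \<open>A\<close> and \<open>B\<close> arrive at the
  same set and \<open>A\<close> is the smaller one, then by injectivity \<open>A\<close> already passes through \<open>B\<close>.
\<close>
lemma middle_layer_map:
  assumes "even n"
  obtains f :: "nat set \<Rightarrow> nat set" where
    "\<And>A. A \<subseteq> {..<n} \<Longrightarrow> 2 * card A \<le> n \<Longrightarrow> A \<subseteq> f A \<and> f A \<subseteq> {..<n} \<and> 2 * card (f A) = n"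
    "\<And>A B. A \<subseteq> {..<n} \<Longrightarrow> 2 * card A \<le> n \<Longrightarrow> B \<subseteq> {..<n} \<Longrightarrow> 2 * card B \<le> n \<Longrightarrow>
       f A = f B \<Longrightarrow> A \<subseteq> B \<or> B \<subseteq> A"
proof -
  obtain m where n: "n = 2 * m" using assms by (rule evenE)
  obtain \<phi> where up: "\<And>A. A \<subseteq> {..<n} \<Longrightarrow> 2 * card A < n \<Longrightarrow>
       A \<subseteq> \<phi> A \<and> \<phi> A \<subseteq> {..<n} \<and> card (\<phi> A) = Suc (card A)"
    and inj: "inj_on \<phi> {A. A \<subseteq> {..<n} \<and> 2 * card A < n}"
    using first_peak_injection[of n] by blast
  have iter: "A \<subseteq> (\<phi> ^^ k) A \<and> (\<phi> ^^ k) A \<subseteq> {..<n} \<and> card ((\<phi> ^^ k) A) = card A + k"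
    if "A \<subseteq> {..<n}" "card A + k \<le> m" for A k
    using that
  proof (induction k)
    case (Suc k)
    then have "A \<subseteq> (\<phi> ^^ k) A" "(\<phi> ^^ k) A \<subseteq> {..<n}" "card ((\<phi> ^^ k) A) = card A + k" by auto
    with up[of "(\<phi> ^^ k) A"] Suc.prems n show ?case by auto
  qed simp
  have iter_inj: "A = B"
    if "A \<subseteq> {..<n}" "B \<subseteq> {..<n}" "card A = card B" "card A + k \<le> m" "(\<phi> ^^ k) A = (\<phi> ^^ k) B" for A B k
    using that
  proof (induction k)
    case (Suc k)
    have "(\<phi> ^^ k) A = (\<phi> ^^ k) B"
    proof (rule inj_onD[OF inj])
      show "\<phi> ((\<phi> ^^ k) A) = \<phi> ((\<phi> ^^ k) B)" using Suc.prems by simp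
    qed (use iter[of A k] iter[of B k] Suc.prems n in auto)
    then show ?case using Suc by simp
  qed simp
  define f where "f A = (\<phi> ^^ (m - card A)) A" for A
  have chain: "A \<subseteq> B"
    if "A \<subseteq> {..<n}" "B \<subseteq> {..<n}" "card B \<le> m" "card A \<le> card B" "f A = f B" for A B
  proof -
    let ?A = "(\<phi> ^^ (card B - card A)) A"
    have A: "A \<subseteq> ?A" "?A \<subseteq> {..<n}" "card ?A = card B"
      using iter[of A "card B - card A"] that by auto
    have "m - card A = (m - card B) + (card B - card A)" using that by simp
    then have "(\<phi> ^^ (m - card B)) ?A = (\<phi> ^^ (m - card B)) B"
      using that(5) unfolding f_def by (simp add: funpow_add)
    then have "?A = B" using iter_inj[of ?A B "m - card B"] A that by simp
    then show ?thesis using A by simp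
  qed
  show ?thesis
  proof
    show "A \<subseteq> f A \<and> f A \<subseteq> {..<n} \<and> 2 * card (f A) = n"
      if "A \<subseteq> {..<n}" "2 * card A \<le> n" for A
      using iter[of A "m - card A"] that n by (auto simp: f_def)
    show "A \<subseteq> B \<or> B \<subseteq> A"
      if "A \<subseteq> {..<n}" "2 * card A \<le> n" "B \<subseteq> {..<n}" "2 * card B \<le> n" "f A = f B" for A B
      using chain[of A B] chain[of B A] that n by (cases "card A \<le> card B") auto
  qed
qed

section \<open>Crossing sets\<close>

definition crossing :: "nat \<Rightarrow> nat set \<Rightarrow> nat set \<Rightarrow> bool" where
  "crossing n A B \<longleftrightarrow>
     A \<inter> B \<noteq> {} \<and> A - B \<noteq> {} \<and> B - A \<noteq> {} \<and> {..<n} - (A \<union> B) \<noteq> {}"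

definition half_star :: "nat \<Rightarrow> nat set set" where
  "half_star n = {C. C \<subseteq> {..<n} \<and> 0 \<in> C \<and> 2 * card C = n}"

text \<open>Sets of the same size are incomparable, and two sets of size \<open>n/2\<close> that share the element
  \<open>0\<close> cannot cover \<open>n\<close> points.\<close>
lemma half_star_crossing:
  assumes A: "A \<in> half_star n" and B: "B \<in> half_star n" and "A \<noteq> B"
  shows "crossing n A B"
proof -
  have fin: "finite A" "finite B"
    using A B finite_subset by (auto simp: half_star_def)
  have "card A = card B" using A B by (auto simp: half_star_def)
  then have "\<not> A \<subseteq> B" "\<not> B \<subseteq> A"
    using fin \<open>A \<noteq> B\<close> card_subset_eq by metis+
  moreover have "0 \<in> A \<inter> B" using A B by (auto simp: half_star_def)
  moreover have "{..<n} - (A \<union> B) \<noteq> {}"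
  proof
    assume "{..<n} - (A \<union> B) = {}"
    then have "A \<union> B = {..<n}" using A B by (auto simp: half_star_def)
    then have "card A + card B = n + card (A \<inter> B)"
      using card_Un_Int[OF fin] by simp
    moreover have "card (A \<inter> B) > 0"
      using \<open>0 \<in> A \<inter> B\<close> fin by (auto simp: card_gt_0_iff)
    ultimately show False using A B by (simp add: half_star_def)
  qed
  ultimately show ?thesis by (auto simp: crossing_def)
qed

text \<open>
  After replacing each of two crossing sets by the smaller of itself and its complement they still
  cross. Equal colours mean that their images in the middle layer are equal, which makes the sets
  comparable, or complementary, which makes them disjoint.
\<close>
lemma half_star_crossing_retraction:
  assumes "even n"
  obtains g :: "nat set \<Rightarrow> nat set" where
    "\<And>A. 0 < n \<Longrightarrow> A \<subseteq> {..<n} \<Longrightarrow> g A \<in> half_star n"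
    "\<And>A B. A \<subseteq> {..<n} \<Longrightarrow> B \<subseteq> {..<n} \<Longrightarrow> crossing n A B \<Longrightarrow> g A \<noteq> g B"
proof -
  obtain f where f: "\<And>A. A \<subseteq> {..<n} \<Longrightarrow> 2 * card A \<le> n \<Longrightarrow>
       A \<subseteq> f A \<and> f A \<subseteq> {..<n} \<and> 2 * card (f A) = n"
    and chain: "\<And>A B. A \<subseteq> {..<n} \<Longrightarrow> 2 * card A \<le> n \<Longrightarrow> B \<subseteq> {..<n} \<Longrightarrow> 2 * card B \<le> n \<Longrightarrow>
       f A = f B \<Longrightarrow> A \<subseteq> B \<or> B \<subseteq> A"
    using middle_layer_map[OF assms] by blast
  define small where "small A = (if 2 * card A \<le> n then A else {..<n} - A)" for A
  define star where "star C = (if 0 \<in> C then C else {..<n} - C)" for C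
  have card_compl: "card ({..<n} - A) = n - card A" if "A \<subseteq> {..<n}" for A
    using that by (simp add: card_Diff_subset finite_subset[OF that])
  have small: "small A \<subseteq> {..<n}" "2 * card (small A) \<le> n" if "A \<subseteq> {..<n}" for A
    using that card_compl[OF that] by (auto simp: small_def)
  have small_crossing: "crossing n (small A) (small B)"
    if "A \<subseteq> {..<n}" "B \<subseteq> {..<n}" "crossing n A B" for A B
    using that unfolding small_def crossing_def by auto
  have star_eq: "C = D \<or> C \<inter> D = {}" if "C \<subseteq> {..<n}" "D \<subseteq> {..<n}" "star C = star D" for C D
    using that unfolding star_def by (auto split: if_splits)
  show ?thesis
  proof
    fix A assume A: "A \<subseteq> {..<n}" and "0 < n"
    then show "star (f (small A)) \<in> half_star n"
      using f[OF small[OF A]] card_compl[of "f (small A)"] by (auto simp: star_def half_star_def)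
  next
    fix A B assume AB: "A \<subseteq> {..<n}" "B \<subseteq> {..<n}" "crossing n A B"
    note sA = small[OF AB(1)] and sB = small[OF AB(2)]
    show "star (f (small A)) \<noteq> star (f (small B))"
    proof
      assume "star (f (small A)) = star (f (small B))"
      then have "f (small A) = f (small B) \<or> f (small A) \<inter> f (small B) = {}"
        using star_eq f[OF sA] f[OF sB] by blast
      then have "small A \<subseteq> small B \<or> small B \<subseteq> small A \<or> small A \<inter> small B = {}"
        using chain[OF sA sB] f[OF sA] f[OF sB] by blast
      then show False using small_crossing[OF AB] by (auto simp: crossing_def)
    qed
  qed
qed

section \<open>Colourings and covering arrays\<close>

lemma qualitatively_independent_iff_crossing:
  assumes "u \<in> {..<n} \<rightarrow> {0, 1}" "v \<in> {..<n} \<rightarrow> {0, 1}"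
  shows "qualitatively_independent n u v \<longleftrightarrow>
           crossing n {i. i < n \<and> u i = 1} {i. i < n \<and> v i = 1}"
proof -
  let ?U = "{i. i < n \<and> u i = 1}" and ?V = "{i. i < n \<and> v i = 1}"
  have zero: "u i = 0 \<longleftrightarrow> u i \<noteq> 1" "v i = 0 \<longleftrightarrow> v i \<noteq> 1" if "i < n" for i
  proof -
    have "u i \<in> {0, 1}" "v i \<in> {0, 1}" using assms that by blast+
    then show "u i = 0 \<longleftrightarrow> u i \<noteq> 1" "v i = 0 \<longleftrightarrow> v i \<noteq> 1" by auto
  qed
  have "?U \<inter> ?V \<noteq> {} \<longleftrightarrow> (\<exists>i<n. u i = 1 \<and> v i = 1)" by blast
  moreover have "?U - ?V \<noteq> {} \<longleftrightarrow> (\<exists>i<n. u i = 1 \<and> v i = 0)" using zero by blast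
  moreover have "?V - ?U \<noteq> {} \<longleftrightarrow> (\<exists>i<n. u i = 0 \<and> v i = 1)" using zero by blast
  moreover have "{..<n} - (?U \<union> ?V) \<noteq> {} \<longleftrightarrow> (\<exists>i<n. u i = 0 \<and> v i = 0)" using zero by blast
  ultimately show ?thesis
    unfolding qualitatively_independent_def crossing_def by (simp only: ball_simps) blast
qed

lemma proper_coloring_chromatic_number:
  assumes "graph G"
  shows "\<exists>c. proper_coloring G (chromatic_number G) c"
proof -
  interpret graph G by fact
  obtain c where c: "bij_betw c (verts G) {..<card (verts G)}"
    using ex_bij_betw_finite_nat[OF finite_verts] by (auto simp: atLeast0LessThan)
  have "c u \<noteq> c v" if "u \<rightarrow>\<^bsub>G\<^esub> v" for u v
    using that adj_in_verts[OF that] adj_not_same inj_onD[OF bij_betw_imp_inj_on[OF c]] by metis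
  then have "proper_coloring G (card (verts G)) c"
    using bij_betw_imp_funcset[OF c] by (auto simp: proper_coloring_def)
  then have "\<exists>k c. proper_coloring G k c" by blast
  then show ?thesis unfolding chromatic_number_def by (rule LeastI_ex)
qed

text \<open>With one column for each set of vertices, every pattern on two rows occurs.\<close>
lemma covering_array_complete_graph_exists:
  "\<exists>n A. 0 < n \<and> covering_array n (complete_graph m) A"
proof -
  let ?n = "card (Pow {..<m})"
  obtain e where e: "bij_betw e {..<?n} (Pow {..<m})"
    using ex_bij_betw_nat_finite[of "Pow {..<m}"] by (auto simp: atLeast0LessThan)
  define A where "A u i = (if u \<in> e i then 1 else 0 :: nat)" for u i
  have "qualitatively_independent ?n (A u) (A v)" if uv: "u < m" "v < m" "u \<noteq> v" for u v
    unfolding qualitatively_independent_def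
  proof (intro ballI)
    fix a b :: nat assume ab: "a \<in> {0, 1}" "b \<in> {0, 1}"
    let ?S = "{w. w = u \<and> a = 1 \<or> w = v \<and> b = 1}"
    have "?S \<in> e ` {..<?n}" using uv bij_betw_imp_surj_on[OF e] by auto
    then obtain i where "i < ?n" "e i = ?S" by auto
    then show "\<exists>i<?n. A u i = a \<and> A v i = b"
      using ab uv by (intro exI[of _ i]) (auto simp: A_def)
  qed
  then have "covering_array ?n (complete_graph m) A"
    by (auto simp: covering_array_def complete_graph_def A_def arcs_ends_def arc_to_ends_def)
  moreover have "0 < ?n" by (simp add: card_Pow)
  ultimately show ?thesis by blast
qed

lemma covering_array_proper_coloring:
  assumes "graph G" "proper_coloring G k c" "covering_array n (complete_graph k) A"
  shows "covering_array n G (A \<circ> c)"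
proof -
  interpret graph G by fact
  have "c u \<rightarrow>\<^bsub>complete_graph k\<^esub> c v" if "u \<rightarrow>\<^bsub>G\<^esub> v" for u v
    using assms(2) that adj_in_verts[OF that]
    by (force simp: proper_coloring_def complete_graph_def arcs_ends_def arc_to_ends_def)
  moreover have "A (c u) \<in> {..<n} \<rightarrow> {0, 1}" if "u \<in> verts G" for u
  proof -
    have "c u \<in> verts (complete_graph k)"
      using assms(2) that by (auto simp: proper_coloring_def complete_graph_def)
    then show ?thesis using assms(3) unfolding covering_array_def by blast
  qed
  ultimately show ?thesis
    using assms(3) by (auto simp: covering_array_def)
qed

lemma covering_array_Suc:
  assumes "covering_array n G A"
  shows "covering_array (Suc n) G (\<lambda>u i. if i < n then A u i else 0)"
proof -
  have "qualitatively_independent (Suc n) (\<lambda>i. if i < n then u i else 0) (\<lambda>i. if i < n then v i else 0)"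
    if "qualitatively_independent n u v" for u v
    using that unfolding qualitatively_independent_def by (meson less_SucI)
  then show ?thesis using assms by (auto simp: covering_array_def Pi_iff)
qed

text \<open>
  The rows of the given array are coloured by \<open>half_star n\<close>, so \<open>\<chi>(G)\<close> is at most the size of this
  family, and any \<open>\<chi>(G)\<close> of its members are the rows of the new array.
\<close>
lemma covering_array_complete_chromatic:
  assumes "graph G" "covering_array n G A" "even n" "0 < n"
  shows "\<exists>B. covering_array n (complete_graph (chromatic_number G)) B"
proof -
  interpret graph G by fact
  obtain g where g: "\<And>S. S \<subseteq> {..<n} \<Longrightarrow> g S \<in> half_star n"
    and g_neq: "\<And>S T. S \<subseteq> {..<n} \<Longrightarrow> T \<subseteq> {..<n} \<Longrightarrow> crossing n S T \<Longrightarrow> g S \<noteq> g T"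
    using half_star_crossing_retraction[OF \<open>even n\<close>] \<open>0 < n\<close> by metis
  have "finite (half_star n)"
    by (rule finite_subset[of _ "Pow {..<n}"]) (auto simp: half_star_def)
  then obtain h where h: "bij_betw h (half_star n) {..<card (half_star n)}"
    using ex_bij_betw_finite_nat by (auto simp: atLeast0LessThan)
  define row where "row u = {i. i < n \<and> A u i = 1}" for u
  have row: "row u \<subseteq> {..<n}" for u by (auto simp: row_def)
  have "h (g (row u)) \<noteq> h (g (row v))" if "u \<rightarrow>\<^bsub>G\<^esub> v" for u v
  proof -
    have "A u \<in> {..<n} \<rightarrow> {0, 1}" "A v \<in> {..<n} \<rightarrow> {0, 1}"
      and "qualitatively_independent n (A u) (A v)"
      using assms(2) that adj_in_verts[OF that] unfolding covering_array_def by blast+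
    then have "crossing n (row u) (row v)"
      unfolding row_def by (simp add: qualitatively_independent_iff_crossing)
    then show ?thesis
      using g_neq g row inj_onD[OF bij_betw_imp_inj_on[OF h]] by metis
  qed
  then have "proper_coloring G (card (half_star n)) (\<lambda>u. h (g (row u)))"
    using g row bij_betw_imp_funcset[OF h] by (auto simp: proper_coloring_def)
  then have le: "chromatic_number G \<le> card (half_star n)"
    unfolding chromatic_number_def by (intro Least_le) blast
  obtain e where e: "bij_betw e {..<card (half_star n)} (half_star n)"
    using bij_betw_inv_into[OF h] by blast
  define B where "B u i = (if i \<in> e u then 1 else 0 :: nat)" for u i
  have "qualitatively_independent n (B u) (B v)"
    if "u < chromatic_number G" "v < chromatic_number G" "u \<noteq> v" for u v
  proof -
    have mem: "e u \<in> half_star n" "e v \<in> half_star n" and "e u \<noteq> e v"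
      using that le bij_betw_imp_funcset[OF e] bij_betw_imp_inj_on[OF e] by (auto simp: inj_on_def)
    then have "crossing n (e u) (e v)" using half_star_crossing by blast
    moreover have "{i. i < n \<and> B w i = 1} = e w" if "e w \<in> half_star n" for w
      using that by (auto simp: B_def half_star_def)
    moreover have "B w \<in> {..<n} \<rightarrow> {0, 1}" for w by (auto simp: B_def)
    ultimately show ?thesis using mem by (simp add: qualitatively_independent_iff_crossing)
  qed
  then have "covering_array n (complete_graph (chromatic_number G)) B"
    by (auto simp: covering_array_def complete_graph_def B_def arcs_ends_def arc_to_ends_def)
  then show ?thesis by blast
qed

lemma CAN_le: "0 < n \<Longrightarrow> covering_array n G A \<Longrightarrow> CAN G \<le> n"
  unfolding CAN_def by (rule Least_le) blast

lemma CAN_attained: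
  assumes "0 < n" "covering_array n G A"
  shows "0 < CAN G \<and> (\<exists>A. covering_array (CAN G) G A)"
  unfolding CAN_def by (rule LeastI[of _ n]) (use assms in blast)

theorem corollary5p3p6:
  fixes G :: "('a, 'b) pre_digraph"
  assumes "graph G"
  shows "int (CAN (complete_graph (chromatic_number G))) - 1 \<le> int (CAN G) \<and>
         CAN G \<le> CAN (complete_graph (chromatic_number G)) \<and>
         (odd (CAN (complete_graph (chromatic_number G))) \<longrightarrow>
            CAN G = CAN (complete_graph (chromatic_number G)))"
proof -
  let ?K = "complete_graph (chromatic_number G)"
  obtain c where c: "proper_coloring G (chromatic_number G) c"
    using proper_coloring_chromatic_number[OF assms] by blast
  obtain A where K: "0 < CAN ?K" "covering_array (CAN ?K) ?K A"
    using covering_array_complete_graph_exists CAN_attained by metis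
  note GA = covering_array_proper_coloring[OF assms c K(2)]
  have upper: "CAN G \<le> CAN ?K" using CAN_le[OF K(1) GA] .
  obtain B where G: "0 < CAN G" "covering_array (CAN G) G B"
    using CAN_attained[OF K(1) GA] by blast
  have even_case: "CAN ?K \<le> CAN G" if "even (CAN G)"
    using covering_array_complete_chromatic[OF assms G(2) that G(1)] CAN_le[OF G(1)] by blast
  have odd_case: "CAN ?K \<le> Suc (CAN G)" if "odd (CAN G)"
    using covering_array_complete_chromatic[OF assms covering_array_Suc[OF G(2)]] that CAN_le by auto
  (* If CAN of the complete graph were odd and different from CAN G, then CAN G would be one
     less, hence even, and the loss would not occur. *)
  show ?thesis
    using upper even_case odd_case by (cases "even (CAN G)") (auto simp: le_Suc_eq)
qed

end
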